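(* Let Alice and Bob hold systems $A$ and $B$, each with Hilbert space $\mathbb{C}^5$ and standard orthonormal basis $|0\rangle,\dots,|4\rangle$. Consider the following set of 17 mutually orthogonal (unnormalized) product states in $\mathbb{C}^5\otimes\mathbb{C}^5$ (first factor Alice, second factor Bob): $$\begin{aligned} &|\phi_{1}\rangle=|0\rangle|0-1+2-3\rangle,\quad |\phi_{2}\rangle=|0\rangle|0+1-2-3\rangle,\quad |\phi_{3}\rangle=|0\rangle|0-1-2+3\rangle,\\ &|\phi_{4}\rangle=|0-1+2-3\rangle|4\rangle,\quad |\phi_{5}\rangle=|0+1-2-3\rangle|4\rangle,\quad |\phi_{6}\rangle=|0-1-2+3\rangle|4\rangle,\\ &|\phi_{7}\rangle=|4\rangle|1-2+3-4\rangle,\quad |\phi_{8}\rangle=|4\rangle|1+2-3-4\rangle,\quad |\phi_{9}\rangle=|4\rangle|1-2-3+4\rangle,\\ &|\phi_{10}\rangle=|1-2+3-4\rangle|0\rangle,\quad |\phi_{11}\rangle=|1+2-3-4\rangle|0\rangle,\quad |\phi_{12}\rangle=|1-2-3+4\rangle|0\rangle,\\ &|\phi_{13}\rangle=|1\rangle|1-2\rangle,\quad |\phi_{14}\rangle=|1-2\rangle|3\rangle,\quad |\phi_{15}\rangle=|3\rangle|2-3\rangle,\quad |\phi_{16}\rangle=|2-3\rangle|1\rangle,\\ &|F\rangle=|0+1+2+3+4\rangle|0+1+2+3+4\rangle . \end{aligned}$$ Then the states $|\phi_1\rangle,\dots,|\phi_{16}\rangle,|F\rangle$ can be perfectly distinguished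 by LOCC with the assistance of two copies of a $2\otimes 2$ maximally entangled state shared between Alice and Bob.
   Context: Notation: $|i\pm j\pm\cdots\rangle$ means $|i\rangle\pm|j\rangle\pm\cdots$ (inside the ket the labels are basis labels, not numbers to be added), and normalization constants are ignored. A $2\otimes 2$ maximally entangled state is the state (proportional to) $|00\rangle+|11\rangle\in\mathbb{C}^2\otimes\mathbb{C}^2$. Two copies means the shared state $|\Psi\rangle=|\Psi\rangle_{a_1b_1}\otimes|\Psi\rangle_{a_2b_2}$ with each factor $|00\rangle+|11\rangle$, where Alice holds $a=a_1a_2$ and Bob holds $b=b_1b_2$. LOCC (local operations and classical communication): a protocol consists of finitely many rounds; in each round one of the parties performs a quantum measurement (Kraus operators $\{M_x\}$ with $\sum_x M_x^\dagger M_x=I$) acting only on that party's own systems, the choice of the measurement being allowed to depend on all previous outcomes, and the outcome is communicated to the other party. A finite set $S$ of pairwise orthogonal states of $AB$ is perfectly distinguished by LOCC with the assistance of a shared entangled state $|\Psi\rangle_{ab}$ if there is an LOCC protocol, in which Alice acts on $aA$ and Bob acts on $bB$, such that when it is applied to $|\phi\rangle_{AB}\otimes|\Psi\rangle_{ab}$ with $|\phi\rangle\in S$ unknown, the sequence of measurement outcomes determines $|\phi\rangle$ with certainty; i.e. for every complete sequence of outcomes, at most one $|\phi\rangle\in S$ gives it nonzero probability. *)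

theory Defs
  imports "HOL-Analysis.Analysis"
begin

section \<open>Finite-dimensional quantum systems\<close>

text \<open>A system with basis labels in a finite type \<open>'a\<close> has state space \<open>complex ^ 'a\<close>;
  a bipartite system has state space \<open>complex ^ ('a \<times> 'b)\<close>, Alice's label coming first.
  State vectors are not assumed to be normalized.\<close>

definition ket :: "'a::finite \<Rightarrow> complex ^ 'a" where
  "ket i = axis i 1"

definition cinner :: "complex ^ 'a::finite \<Rightarrow> complex ^ 'a \<Rightarrow> complex" where
  "cinner u v = (\<Sum>i\<in>UNIV. cnj (u $ i) * v $ i)"

definition tensor_vec ::
  "complex ^ 'a::finite \<Rightarrow> complex ^ 'b::finite \<Rightarrow> complex ^ ('a \<times> 'b)"  (infixl \<open>\<otimes>\<close> 70) where
  "u \<otimes> v = (\<chi> p. u $ fst p * v $ snd p)"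

definition tensor_mat ::
  "complex ^ 'a ^ 'a::finite \<Rightarrow> complex ^ 'b ^ 'b::finite
    \<Rightarrow> complex ^ ('a \<times> 'b) ^ ('a \<times> 'b)"  (infixl \<open>\<otimes>\<^sub>m\<close> 70) where
  "M \<otimes>\<^sub>m N = (\<chi> p q. M $ fst p $ fst q * N $ snd p $ snd q)"

text \<open>Tensor product of two bipartite states, with the tensor factors regrouped so that
  the two subsystems of Alice come first and the two subsystems of Bob come second.\<close>

definition tensor_bipartite ::
  "complex ^ ('a::finite \<times> 'b::finite) \<Rightarrow> complex ^ ('c::finite \<times> 'd::finite)
    \<Rightarrow> complex ^ (('a \<times> 'c) \<times> ('b \<times> 'd))"  (infixl \<open>\<otimes>\<^sub>b\<close> 70) where
  "\<Psi> \<otimes>\<^sub>b \<phi> = (\<chi> p. case p of ((i, k), (j, l)) \<Rightarrow> \<Psi> $ (i, j) * \<phi> $ (k, l))"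

definition dagger :: "complex ^ 'n::finite ^ 'm::finite \<Rightarrow> complex ^ 'm ^ 'n" where
  "dagger M = (\<chi> i j. cnj (M $ j $ i))"


section \<open>LOCC protocols\<close>

text \<open>A protocol is a tree of rounds. In \<open>Alice n M p\<close>, Alice performs the measurement with
  outcomes \<open>x < n\<close> and Kraus operators \<open>M x\<close>, announces \<open>x\<close>, and the parties continue with
  \<open>p x\<close>; the values of \<open>M\<close> and \<open>p\<close> at arguments \<open>x \<ge> n\<close> are irrelevant.\<close>

datatype ('a, 'b) protocol =
    Stop
  | Alice nat "nat \<Rightarrow> complex ^ 'a ^ 'a" "nat \<Rightarrow> ('a, 'b) protocol"
  | Bob nat "nat \<Rightarrow> complex ^ 'b ^ 'b" "nat \<Rightarrow> ('a, 'b) protocol"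

definition measurement :: "nat \<Rightarrow> (nat \<Rightarrow> complex ^ 'a ^ 'a::finite) \<Rightarrow> bool" where
  "measurement n M \<longleftrightarrow> (\<Sum>x<n. dagger (M x) ** M x) = mat 1"

primrec locc :: "('a::finite, 'b::finite) protocol \<Rightarrow> bool" where
  "locc Stop \<longleftrightarrow> True"
| "locc (Alice n M p) \<longleftrightarrow> measurement n M \<and> (\<forall>x<n. locc (p x))"
| "locc (Bob n M p) \<longleftrightarrow> measurement n M \<and> (\<forall>x<n. locc (p x))"

primrec complete_outcomes :: "('a::finite, 'b::finite) protocol \<Rightarrow> nat list set" where
  "complete_outcomes Stop = {[]}"
| "complete_outcomes (Alice n M p) = (\<Union>x<n. (#) x ` complete_outcomes (p x))"
| "complete_outcomes (Bob n M p) = (\<Union>x<n. (#) x ` complete_outcomes (p x))"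

text \<open>The unnormalized state after a given complete sequence of outcomes.\<close>

primrec post_state :: "('a::finite, 'b::finite) protocol \<Rightarrow> nat list
    \<Rightarrow> complex ^ ('a \<times> 'b) \<Rightarrow> complex ^ ('a \<times> 'b)" where
  "post_state Stop xs \<psi> = \<psi>"
| "post_state (Alice n M p) xs \<psi> =
     post_state (p (hd xs)) (tl xs) ((M (hd xs) \<otimes>\<^sub>m mat 1) *v \<psi>)"
| "post_state (Bob n M p) xs \<psi> =
     post_state (p (hd xs)) (tl xs) ((mat 1 \<otimes>\<^sub>m M (hd xs)) *v \<psi>)"

definition outcome_prob ::
  "('a::finite, 'b::finite) protocol \<Rightarrow> complex ^ ('a \<times> 'b) \<Rightarrow> nat list \<Rightarrow> real" where
  "outcome_prob p \<psi> xs = (norm (post_state p xs \<psi>))\<^sup>2 / (norm \<psi>)\<^sup>2"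

definition distinguishable_with ::
  "complex ^ ('a::finite \<times> 'b::finite) \<Rightarrow> (complex ^ ('c::finite \<times> 'd::finite)) set \<Rightarrow> bool" where
  "distinguishable_with \<Psi> S \<longleftrightarrow>
     (\<exists>p :: ('a \<times> 'c, 'b \<times> 'd) protocol. locc p \<and>
        (\<forall>xs \<in> complete_outcomes p. \<forall>\<phi>\<in>S. \<forall>\<phi>'\<in>S.
           outcome_prob p (\<Psi> \<otimes>\<^sub>b \<phi>) xs \<noteq> 0 \<and> outcome_prob p (\<Psi> \<otimes>\<^sub>b \<phi>') xs \<noteq> 0
             \<longrightarrow> \<phi> = \<phi>'))"


section \<open>The states\<close>

definition bell :: "complex ^ (2 \<times> 2)" where
  "bell = ket 0 \<otimes> ket 0 + ket 1 \<otimes> ket 1"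

definition states_list :: "(complex ^ (5 \<times> 5)) list" where
  "states_list =
    [ket 0 \<otimes> (ket 0 - ket 1 + ket 2 - ket 3),
     ket 0 \<otimes> (ket 0 + ket 1 - ket 2 - ket 3),
     ket 0 \<otimes> (ket 0 - ket 1 - ket 2 + ket 3),
     (ket 0 - ket 1 + ket 2 - ket 3) \<otimes> ket 4,
     (ket 0 + ket 1 - ket 2 - ket 3) \<otimes> ket 4,
     (ket 0 - ket 1 - ket 2 + ket 3) \<otimes> ket 4,
     ket 4 \<otimes> (ket 1 - ket 2 + ket 3 - ket 4),
     ket 4 \<otimes> (ket 1 + ket 2 - ket 3 - ket 4),
     ket 4 \<otimes> (ket 1 - ket 2 - ket 3 + ket 4),
     (ket 1 - ket 2 + ket 3 - ket 4) \<otimes> ket 0,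
     (ket 1 + ket 2 - ket 3 - ket 4) \<otimes> ket 0,
     (ket 1 - ket 2 - ket 3 + ket 4) \<otimes> ket 0,
     ket 1 \<otimes> (ket 1 - ket 2),
     (ket 1 - ket 2) \<otimes> ket 3,
     ket 3 \<otimes> (ket 2 - ket 3),
     (ket 2 - ket 3) \<otimes> ket 1,
     (ket 0 + ket 1 + ket 2 + ket 3 + ket 4) \<otimes> (ket 0 + ket 1 + ket 2 + ket 3 + ket 4)]"

lemma cinner_ket: "cinner (ket i) (ket j) = (if i = j then 1 else 0)"
  by (simp add: cinner_def ket_def axis_def if_distrib[of cnj] if_distrib[of "\<lambda>x. x * _"]
      cong: if_cong)

lemma cinner_linear:
  "cinner (u + v) w = cinner u w + cinner v w"
  "cinner (u - v) w = cinner u w - cinner v w"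
  "cinner w (u + v) = cinner w u + cinner w v"
  "cinner w (u - v) = cinner w u - cinner w v"
  by (simp_all add: cinner_def algebra_simps sum.distrib sum_subtractf)

lemma cinner_tensor_vec: "cinner (u \<otimes> v) (u' \<otimes> v') = cinner u u' * cinner v v'"
  by (simp add: cinner_def tensor_vec_def sum_product sum.cartesian_product
      UNIV_Times_UNIV[symmetric] case_prod_beta mult_ac del: UNIV_Times_UNIV)

lemma states_nonzero: "\<forall>\<phi>\<in>set states_list. cinner \<phi> \<phi> \<noteq> 0"
  by (simp add: states_list_def cinner_tensor_vec cinner_linear cinner_ket)

lemma states_orthogonal: "sorted_wrt (\<lambda>\<phi> \<psi>. cinner \<phi> \<psi> = 0 \<and> cinner \<psi> \<phi> = 0) states_list"
  by (simp add: states_list_def cinner_tensor_vec cinner_linear cinner_ket)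

lemma states_distinct: "distinct states_list"
  unfolding distinct_conv_nth
proof (intro allI impI)
  fix i j assume "i < length states_list" "j < length states_list" "i \<noteq> j"
  then have "cinner (states_list ! i) (states_list ! j) = 0"
    using states_orthogonal unfolding sorted_wrt_iff_nth_less by (metis linorder_neqE_nat)
  then show "states_list ! i \<noteq> states_list ! j"
    using states_nonzero \<open>i < length states_list\<close> by (metis nth_mem)
qed

lemma card_states: "card (set states_list) = 17"
  using states_distinct by (simp add: distinct_card) (simp add: states_list_def)

lemma states_pairwise_orthogonal:
  "pairwise (\<lambda>\<phi> \<psi>. cinner \<phi> \<psi> = 0) (set states_list)"
  unfolding pairwise_def
proof (intro ballI impI)
  fix \<phi> \<psi> assume "\<phi> \<in> set states_list" "\<psi> \<in> set states_list" "\<phi> \<noteq> \<psi>"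
  then obtain i j where "i < length states_list" "j < length states_list" "i \<noteq> j"
    "\<phi> = states_list ! i" "\<psi> = states_list ! j"
    by (metis in_set_conv_nth)
  then show "cinner \<phi> \<psi> = 0"
    using states_orthogonal unfolding sorted_wrt_iff_nth_less by (metis linorder_neqE_nat)
qed

end

theory Submission imports Defs begin

text \<open>The two Bell pairs form a maximally entangled pair of four-dimensional registers, which lets
  Alice hand Bob a coherent copy of a four-valued function of her label: the labels \<open>0\<close>, \<open>1\<close>, \<open>4\<close>
  get tags of their own, while \<open>2\<close> and \<open>3\<close> share one. The states other than \<open>F\<close> live on the tiles
  of a \<open>5 \<times> 5\<close> pinwheel, \<open>F\<close> restricts on each tile to the uniform vector, and on every
  tile the restrictions are pairwise orthogonal. Bob, who sees the tag and his own label, peels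
  off the four outer tiles and two of the inner ones; Alice then splits off the inner tile in her
  row \<open>3\<close>, and Bob separates the last tile from the centre. Each piece is a row or a column, so
  a measurement by one party finishes.\<close>

section \<open>Distinguishing families of states\<close>

text \<open>The index stays fixed while the vectors change from round to round, so the original
  state is still what has to be identified when current vectors coincide or vanish.\<close>

definition locc_dist :: "'i set \<Rightarrow> ('i \<Rightarrow> complex ^ ('a::finite \<times> 'b::finite)) \<Rightarrow> bool" where
  "locc_dist S \<Psi> \<longleftrightarrow> (\<exists>p. locc p \<and> (\<forall>xs \<in> complete_outcomes p. \<forall>\<phi>\<in>S. \<forall>\<phi>'\<in>S.
     post_state p xs (\<Psi> \<phi>) \<noteq> 0 \<and> post_state p xs (\<Psi> \<phi>') \<noteq> 0 \<longrightarrow> \<phi> = \<phi>'))"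

text \<open>A nonzero outcome probability forces a nonzero final vector, so the norms of the inputs
  can be ignored.\<close>

lemma distinguishable_withI:
  assumes "locc_dist S (\<lambda>\<phi>. \<Psi> \<otimes>\<^sub>b \<phi>)"
  shows "distinguishable_with \<Psi> S"
  using assms unfolding distinguishable_with_def locc_dist_def outcome_prob_def
  by fastforce

lemma post_state_0: "post_state p xs 0 = 0"
  by (induction p arbitrary: xs) auto

lemma locc_dist_Stop:
  assumes "\<And>\<phi> \<phi>'. \<phi> \<in> S \<Longrightarrow> \<phi>' \<in> S \<Longrightarrow> \<Psi> \<phi> \<noteq> 0 \<Longrightarrow> \<Psi> \<phi>' \<noteq> 0 \<Longrightarrow> \<phi> = \<phi>'"
  shows "locc_dist S \<Psi>"
  unfolding locc_dist_def by (rule exI[of _ Stop]) (use assms in auto)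

lemma locc_dist_insert_zero:
  assumes "locc_dist S \<Psi>" "\<Psi> \<phi> = 0"
  shows "locc_dist (insert \<phi> S) \<Psi>"
  using assms unfolding locc_dist_def by (metis insert_iff post_state_0)

lemma locc_dist_cong:
  assumes "locc_dist S \<Psi>" "\<And>\<phi>. \<phi> \<in> S \<Longrightarrow> \<Psi>' \<phi> = \<Psi> \<phi>"
  shows "locc_dist S \<Psi>'"
  using assms unfolding locc_dist_def by metis

text \<open>Enumerating an arbitrary finite outcome set \<open>X\<close> by \<open>h\<close> and
  hanging the protocols of the branches below one round yields a protocol tree.\<close>

lemma locc_dist_Alice:
  assumes X: "finite X" and M: "(\<Sum>x\<in>X. dagger (M x) ** M x) = mat 1"
    and D: "\<And>x. x \<in> X \<Longrightarrow> locc_dist S (\<lambda>\<phi>. (M x \<otimes>\<^sub>m mat 1) *v \<Psi> \<phi>)"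
  shows "locc_dist S \<Psi>"
proof -
  obtain h where h: "bij_betw h {..<card X} X"
    using ex_bij_betw_nat_finite[OF X] by (auto simp: atLeast0LessThan)
  obtain p where p: "\<And>x. x \<in> X \<Longrightarrow> locc (p x) \<and> (\<forall>xs \<in> complete_outcomes (p x). \<forall>\<phi>\<in>S. \<forall>\<phi>'\<in>S.
     post_state (p x) xs ((M x \<otimes>\<^sub>m mat 1) *v \<Psi> \<phi>) \<noteq> 0 \<and>
     post_state (p x) xs ((M x \<otimes>\<^sub>m mat 1) *v \<Psi> \<phi>') \<noteq> 0 \<longrightarrow> \<phi> = \<phi>')"
    using D unfolding locc_dist_def by metis
  have "measurement (card X) (\<lambda>x. M (h x))"
    unfolding measurement_def using M sum.reindex_bij_betw[OF h, of "\<lambda>x. dagger (M x) ** M x"] by simp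
  moreover have "h x \<in> X" if "x < card X" for x
    using h that by (auto simp: bij_betw_def)
  ultimately show ?thesis
    unfolding locc_dist_def using p
    by (intro exI[of _ "Alice (card X) (\<lambda>x. M (h x)) (\<lambda>x. p (h x))"]) force
qed

lemma locc_dist_Bob:
  assumes X: "finite X" and M: "(\<Sum>x\<in>X. dagger (M x) ** M x) = mat 1"
    and D: "\<And>x. x \<in> X \<Longrightarrow> locc_dist S (\<lambda>\<phi>. (mat 1 \<otimes>\<^sub>m M x) *v \<Psi> \<phi>)"
  shows "locc_dist S \<Psi>"
proof -
  obtain h where h: "bij_betw h {..<card X} X"
    using ex_bij_betw_nat_finite[OF X] by (auto simp: atLeast0LessThan)
  obtain p where p: "\<And>x. x \<in> X \<Longrightarrow> locc (p x) \<and> (\<forall>xs \<in> complete_outcomes (p x). \<forall>\<phi>\<in>S. \<forall>\<phi>'\<in>S.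
     post_state (p x) xs ((mat 1 \<otimes>\<^sub>m M x) *v \<Psi> \<phi>) \<noteq> 0 \<and>
     post_state (p x) xs ((mat 1 \<otimes>\<^sub>m M x) *v \<Psi> \<phi>') \<noteq> 0 \<longrightarrow> \<phi> = \<phi>')"
    using D unfolding locc_dist_def by metis
  have "measurement (card X) (\<lambda>x. M (h x))"
    unfolding measurement_def using M sum.reindex_bij_betw[OF h, of "\<lambda>x. dagger (M x) ** M x"] by simp
  moreover have "h x \<in> X" if "x < card X" for x
    using h that by (auto simp: bij_betw_def)
  ultimately show ?thesis
    unfolding locc_dist_def using p
    by (intro exI[of _ "Bob (card X) (\<lambda>x. M (h x)) (\<lambda>x. p (h x))"]) force
qed


section \<open>Local operations\<close>

lemma Alice_apply:
  "(M \<otimes>\<^sub>m mat 1) *v \<psi> = (\<chi> p. \<Sum>a\<in>UNIV. M $ fst p $ a * \<psi> $ (a, snd p))"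
  by (simp add: vec_eq_iff matrix_vector_mult_def tensor_mat_def mat_def sum.cartesian_product'
      UNIV_Times_UNIV[symmetric] if_distrib if_distribR sum.If_cases
      cong: if_cong del: UNIV_Times_UNIV)

lemma Bob_apply:
  "(mat 1 \<otimes>\<^sub>m M) *v \<psi> = (\<chi> p. \<Sum>b\<in>UNIV. M $ snd p $ b * \<psi> $ (fst p, b))"
proof -
  have "(\<Sum>a\<in>UNIV. \<Sum>b\<in>UNIV. (if i = a then 1 else 0) * M $ j $ b * \<psi> $ (a, b)) =
    (\<Sum>a\<in>UNIV. if i = a then \<Sum>b\<in>UNIV. M $ j $ b * \<psi> $ (a, b) else 0)" for i j
    by (rule sum.cong) auto
  then show ?thesis
    by (simp add: vec_eq_iff matrix_vector_mult_def tensor_mat_def mat_def sum.cartesian_product'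
      UNIV_Times_UNIV[symmetric] del: UNIV_Times_UNIV)
qed

lemma dagger_mult_nth: "(dagger M ** M) $ i $ j = (\<Sum>k\<in>UNIV. cnj (M $ k $ i) * M $ k $ j)"
  by (simp add: matrix_matrix_mult_def dagger_def)

text \<open>\<open>h\<close> maps output labels to input labels, so that the action on components is
  a substitution cut off outside \<open>P\<close>. With \<open>h\<close> the identity this is a
  coordinate projector; other choices of \<open>h\<close> can also reset a register.\<close>

definition relabel :: "'a set \<Rightarrow> ('a \<Rightarrow> 'a) \<Rightarrow> complex ^ 'a ^ 'a::finite" where
  "relabel P h = (\<chi> p q. if p \<in> P \<and> q = h p then 1 else 0)"

lemma relabel_apply_Alice:
  "(relabel P h \<otimes>\<^sub>m mat 1) *v \<psi> = (\<chi> p. if fst p \<in> P then \<psi> $ (h (fst p), snd p) else 0)"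
  by (simp add: Alice_apply relabel_def vec_eq_iff if_distrib[of "\<lambda>x. x * _"] cong: if_cong)

lemma relabel_apply_Bob:
  "(mat 1 \<otimes>\<^sub>m relabel P h) *v \<psi> = (\<chi> p. if snd p \<in> P then \<psi> $ (fst p, h (snd p)) else 0)"
  by (simp add: Bob_apply relabel_def vec_eq_iff if_distrib[of "\<lambda>x. x * _"] cong: if_cong)

text \<open>Each summand is the diagonal projector onto the image of \<open>P x\<close> under
  \<open>h x\<close>, and the bijection says that these images partition the basis.\<close>

lemma relabel_complete:
  assumes X: "finite X" and bij: "bij_betw (\<lambda>(x, p). h x p) (Sigma X P) UNIV"
  shows "(\<Sum>x\<in>X. dagger (relabel (P x) (h x)) ** relabel (P x) (h x)) = mat 1"
proof -
  have "(\<Sum>x\<in>X. dagger (relabel (P x) (h x)) ** relabel (P x) (h x)) $ q $ q' = mat 1 $ q $ q'"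
    for q q'
  proof -
    have "(\<Sum>x\<in>X. dagger (relabel (P x) (h x)) ** relabel (P x) (h x)) $ q $ q' =
      (\<Sum>x\<in>X. \<Sum>p\<in>UNIV. if p \<in> P x then if q = h x p \<and> q' = h x p then 1 else 0 else 0)"
      by (auto simp: dagger_mult_nth relabel_def intro!: sum.cong)
    also have "\<dots> = (\<Sum>x\<in>X. \<Sum>p\<in>P x. if q = h x p \<and> q' = h x p then 1 else 0)"
      by (simp add: sum.If_cases flip: sum.inter_restrict)
    also have "\<dots> = (\<Sum>(x, p)\<in>Sigma X P. if q = h x p \<and> q' = h x p then 1 else 0)"
      by (rule sum.Sigma) (use X in auto)
    also have "\<dots> = (\<Sum>r\<in>UNIV. if q = r \<and> q' = r then 1 else 0)"
      using sum.reindex_bij_betw[OF bij, of "\<lambda>r. if q = r \<and> q' = r then 1 else 0"]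
      by (simp add: case_prod_beta)
    also have "\<dots> = (\<Sum>r\<in>UNIV. if q = r then if q' = q then 1 else 0 else 0)"
      by (rule sum.cong) auto
    also have "\<dots> = mat 1 $ q $ q'"
      by (simp add: mat_def)
    finally show ?thesis .
  qed
  then show ?thesis by (simp add: vec_eq_iff)
qed

lemma locc_dist_relabel_Alice:
  fixes \<Psi> :: "'i \<Rightarrow> complex ^ ('a::finite \<times> 'b::finite)" and h :: "'x \<Rightarrow> 'a \<Rightarrow> 'a"
  assumes "finite X" "bij_betw (\<lambda>(x, p). h x p) (Sigma X P) UNIV"
    and "\<And>x. x \<in> X \<Longrightarrow>
      locc_dist S (\<lambda>\<phi>. \<chi> p. if fst p \<in> P x then \<Psi> \<phi> $ (h x (fst p), snd p) else 0)"
  shows "locc_dist S \<Psi>"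
  by (rule locc_dist_Alice[OF assms(1) relabel_complete[OF assms(1,2)]])
    (simp add: relabel_apply_Alice assms(3))

lemma locc_dist_relabel_Bob:
  fixes \<Psi> :: "'i \<Rightarrow> complex ^ ('a::finite \<times> 'b::finite)" and h :: "'x \<Rightarrow> 'b \<Rightarrow> 'b"
  assumes "finite X" "bij_betw (\<lambda>(x, p). h x p) (Sigma X P) UNIV"
    and "\<And>x. x \<in> X \<Longrightarrow>
      locc_dist S (\<lambda>\<phi>. \<chi> p. if snd p \<in> P x then \<Psi> \<phi> $ (fst p, h x (snd p)) else 0)"
  shows "locc_dist S \<Psi>"
  by (rule locc_dist_Bob[OF assms(1) relabel_complete[OF assms(1,2)]])
    (simp add: relabel_apply_Bob assms(3))

text \<open>Supplies the yes/no measurement of whether the label lies in \<open>C\<close>.\<close>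

lemma bij_partition: "bij_betw (\<lambda>(x, p). p) (SIGMA x:UNIV. if x then C else - C) UNIV"
  by (rule bij_betwI[of _ _ _ "\<lambda>p. (p \<in> C, p)"]) (auto split: if_splits)


section \<open>Orthogonal local states\<close>

text \<open>The orthogonal projector onto the line of \<open>v\<close>, which need not be a unit
  vector.\<close>

definition proj :: "complex ^ 'n \<Rightarrow> complex ^ 'n ^ 'n::finite" where
  "proj v = (\<chi> i j. v $ i * cnj (v $ j) / cinner v v)"

lemma cinner_self_eq_0: "cinner v v = 0 \<longleftrightarrow> v = 0"
proof -
  have "cinner v v = of_real (\<Sum>i\<in>UNIV. (cmod (v $ i))\<^sup>2)"
    by (simp add: cinner_def complex_norm_square mult.commute del: of_real_power)
  then show ?thesis
    by (simp only: of_real_eq_0_iff, subst sum_nonneg_eq_0_iff) (auto simp: vec_eq_iff)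
qed

lemma cnj_cinner: "cnj (cinner u v) = cinner v u"
  by (simp add: cinner_def mult.commute)

lemma proj_mult: "proj v *v u = (cinner v u / cinner v v) *s v"
  by (simp add: vec_eq_iff proj_def matrix_vector_mult_def cinner_def[of v u] sum_distrib_left
      sum_divide_distrib sum_distrib_right mult_ac)

lemma dagger_proj: "dagger (proj v) = proj v"
  by (simp add: vec_eq_iff dagger_def proj_def cnj_cinner mult.commute)

lemma dagger_compl: "dagger (mat 1 - M) = mat 1 - dagger M"
  by (simp add: vec_eq_iff dagger_def mat_def)

lemma proj_idem: "v \<noteq> 0 \<Longrightarrow> proj v ** proj v = proj v"
  by (simp add: matrix_eq proj_mult vector_scalar_commute cinner_self_eq_0
      flip: matrix_vector_mul_assoc)

text \<open>\<open>proj v\<close> and its complement are self-adjoint idempotents, so each Kraus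
  product is the projector itself.\<close>

lemma proj_complete:
  assumes "v \<noteq> 0"
  shows "(\<Sum>x\<in>UNIV. dagger (if x then proj v else mat 1 - proj v) **
    (if x then proj v else mat 1 - proj v)) = mat 1"
  using proj_idem[OF assms]
  by (simp add: UNIV_bool dagger_compl dagger_proj matrix_eq matrix_vector_mult_add_rdistrib
       matrix_vector_mult_diff_rdistrib flip: matrix_vector_mul_assoc)
     (simp add: matrix_vector_mult_diff_distrib matrix_vector_mul_assoc)

lemma tensor_mat_mult_vec: "(M \<otimes>\<^sub>m N) *v (u \<otimes> w) = (M *v u) \<otimes> (N *v w)"
  by (simp add: vec_eq_iff matrix_vector_mult_def tensor_mat_def tensor_vec_def sum_product
      sum.cartesian_product' UNIV_Times_UNIV[symmetric] mult_ac del: UNIV_Times_UNIV)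

lemma tensor_vec_0: "0 \<otimes> w = 0" "w \<otimes> 0 = 0"
  by (simp_all add: vec_eq_iff tensor_vec_def)

text \<open>Alice tests for one state at a time. A positive answer kills all others; a negative one
  kills the tested state and, by orthogonality, leaves the others unchanged for the induction
  hypothesis.\<close>

lemma locc_dist_orthogonal_Alice:
  assumes "finite S" and "\<And>\<phi> \<phi>'. \<phi> \<in> S \<Longrightarrow> \<phi>' \<in> S \<Longrightarrow> \<phi> \<noteq> \<phi>' \<Longrightarrow> cinner (u \<phi>) (u \<phi>') = 0"
  shows "locc_dist S (\<lambda>\<phi>. u \<phi> \<otimes> w)"
  using assms
proof (induction S)
  case empty
  then show ?case by (intro locc_dist_Stop) auto
next
  case (insert \<phi>\<^sub>0 S)
  have IH: "locc_dist S (\<lambda>\<phi>. u \<phi> \<otimes> w)"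
    using insert by auto
  show ?case
  proof (cases "u \<phi>\<^sub>0 = 0")
    case True
    then show ?thesis using IH by (auto intro: locc_dist_insert_zero simp: tensor_vec_0)
  next
    case False
    have o: "proj (u \<phi>\<^sub>0) *v u \<phi> = 0" if "\<phi> \<in> S" for \<phi>
      using insert that by (auto simp: proj_mult)
    have s: "proj (u \<phi>\<^sub>0) *v u \<phi>\<^sub>0 = u \<phi>\<^sub>0"
      using False by (simp add: proj_mult cinner_self_eq_0)
    show ?thesis
    proof (rule locc_dist_Alice[OF _ proj_complete[OF False]], goal_cases)
      case (2 x)
      show ?case
      proof (cases x)
        case True
        then show ?thesis using o
          by (intro locc_dist_Stop) (auto simp: tensor_mat_mult_vec tensor_vec_0)
      next
        case False
        then show ?thesis using o s
          by (auto intro!: locc_dist_insert_zero locc_dist_cong[OF IH]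
              simp: tensor_mat_mult_vec tensor_vec_0 matrix_vector_mult_diff_rdistrib)
      qed
    qed simp
  qed
qed

lemma locc_dist_orthogonal_Bob:
  assumes "finite S" and "\<And>\<phi> \<phi>'. \<phi> \<in> S \<Longrightarrow> \<phi>' \<in> S \<Longrightarrow> \<phi> \<noteq> \<phi>' \<Longrightarrow> cinner (u \<phi>) (u \<phi>') = 0"
  shows "locc_dist S (\<lambda>\<phi>. w \<otimes> u \<phi>)"
  using assms
proof (induction S)
  case empty
  then show ?case by (intro locc_dist_Stop) auto
next
  case (insert \<phi>\<^sub>0 S)
  have IH: "locc_dist S (\<lambda>\<phi>. w \<otimes> u \<phi>)"
    using insert by auto
  show ?case
  proof (cases "u \<phi>\<^sub>0 = 0")
    case True
    then show ?thesis using IH by (auto intro: locc_dist_insert_zero simp: tensor_vec_0)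
  next
    case False
    have o: "proj (u \<phi>\<^sub>0) *v u \<phi> = 0" if "\<phi> \<in> S" for \<phi>
      using insert that by (auto simp: proj_mult)
    have s: "proj (u \<phi>\<^sub>0) *v u \<phi>\<^sub>0 = u \<phi>\<^sub>0"
      using False by (simp add: proj_mult cinner_self_eq_0)
    show ?thesis
    proof (rule locc_dist_Bob[OF _ proj_complete[OF False]], goal_cases)
      case (2 x)
      show ?case
      proof (cases x)
        case True
        then show ?thesis using o
          by (intro locc_dist_Stop) (auto simp: tensor_mat_mult_vec tensor_vec_0)
      next
        case False
        then show ?thesis using o s
          by (auto intro!: locc_dist_insert_zero locc_dist_cong[OF IH]
              simp: tensor_mat_mult_vec tensor_vec_0 matrix_vector_mult_diff_rdistrib)
      qed
    qed simp
  qed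
qed


section \<open>Tagging with a coarse copy of Alice's label\<close>

text \<open>The state once the entanglement is used up: Alice's register is reset to
  \<open>0\<close>, Bob's holds \<open>g i\<close>, and \<open>R\<close> is the region that earlier
  outcomes have left.\<close>

definition tagged :: "('c \<Rightarrow> 'r) \<Rightarrow> ('c \<times> 'd) set \<Rightarrow> complex ^ ('c::finite \<times> 'd::finite)
    \<Rightarrow> complex ^ (('r \<times> 'c) \<times> ('r::{finite,zero} \<times> 'd))" where
  "tagged g R \<phi> = (\<chi> p. case p of ((k, i), (l, j)) \<Rightarrow>
     if k = 0 \<and> l = g i \<and> (i, j) \<in> R then \<phi> $ (i, j) else 0)"

definition cinner_on :: "'a set \<Rightarrow> complex ^ 'a::finite \<Rightarrow> complex ^ 'a \<Rightarrow> complex" where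
  "cinner_on R u v = (\<Sum>i\<in>R. cnj (u $ i) * v $ i)"

text \<open>For a maximally entangled register indexed by a group, Alice's outcome \<open>s\<close> of measuring
  the difference of her register and \<open>g i\<close> leaves \<open>g i + s\<close> in Bob's register.\<close>

lemma locc_dist_tag:
  fixes \<Phi> :: "complex ^ ('r::{finite,ab_group_add} \<times> 'r)"
    and S :: "(complex ^ ('c::finite \<times> 'd::finite)) set" and g :: "'c \<Rightarrow> 'r"
  assumes \<Phi>: "\<And>k l. \<Phi> $ (k, l) = (if k = l then 1 else 0)"
    and D: "locc_dist S (tagged g UNIV)"
  shows "locc_dist S (\<lambda>\<phi>. \<Phi> \<otimes>\<^sub>b \<phi>)"
proof (rule locc_dist_relabel_Alice[where X = UNIV and P = "\<lambda>s. {0} \<times> UNIV"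
      and h = "\<lambda>s p. (g (snd p) + s, snd p)"], goal_cases)
  case 2
  show ?case
    by (rule bij_betwI[of _ _ _ "\<lambda>(k, i). (k - g i, (0, i))"]) auto
next
  case (3 s)
  show ?case
  \<comment> \<open>The single outcome makes this a unitary: Bob subtracts the announced
    \<open>s\<close> from his register, turning \<open>g i + s\<close> into
    \<open>g i\<close>.\<close>
  proof (rule locc_dist_relabel_Bob[where X = "{()}" and P = "\<lambda>_. UNIV"
      and h = "\<lambda>_ p. (fst p + s, snd p)"], goal_cases)
    case 2
    show ?case
      by (rule bij_betwI[of _ _ _ "\<lambda>(l, j). ((), (l - s, j))"]) auto
  next
    case (3 x)
    show ?case
      by (rule locc_dist_cong[OF D])
        (auto simp: vec_eq_iff tagged_def tensor_bipartite_def \<Phi>)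
  qed simp
qed simp

text \<open>No row meets both regions, so asking whether her label is a row of \<open>R\<close>
  leaves one region intact and removes the other.\<close>

lemma locc_dist_split_Alice:
  assumes D: "locc_dist S (tagged g R)" "locc_dist S (tagged g R')"
    and sep: "\<And>i j j'. (i, j) \<in> R \<Longrightarrow> (i, j') \<notin> R'"
  shows "locc_dist S (tagged g (R \<union> R'))"
proof (rule locc_dist_relabel_Alice[OF _ bij_partition[of "UNIV \<times> fst ` R"]], goal_cases)
  case (2 x)
  show ?case
  proof (cases x)
    case True
    show ?thesis
      by (rule locc_dist_cong[OF D(1)])
        (use True sep in \<open>force simp: vec_eq_iff tagged_def\<close>)
  next
    case False
    show ?thesis
      by (rule locc_dist_cong[OF D(2)])
        (use False sep in \<open>force simp: vec_eq_iff tagged_def\<close>)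
  qed
qed simp

text \<open>Bob sees the pair of tag and column; by \<open>sep\<close> no such pair occurs in both
  regions, even where they share a column.\<close>

lemma locc_dist_split_Bob:
  assumes D: "locc_dist S (tagged g R)" "locc_dist S (tagged g R')"
    and sep: "\<And>i i' j. (i, j) \<in> R \<Longrightarrow> (i', j) \<in> R' \<Longrightarrow> g i \<noteq> g i'"
  shows "locc_dist S (tagged g (R \<union> R'))"
proof (rule locc_dist_relabel_Bob[OF _ bij_partition[of "(\<lambda>(i, j). (g i, j)) ` R"]], goal_cases)
  case (2 x)
  show ?case
  proof (cases x)
    case True
    show ?thesis
      by (rule locc_dist_cong[OF D(1)])
        (use True sep in \<open>force simp: vec_eq_iff tagged_def\<close>)
  next
    case False
    show ?thesis
      by (rule locc_dist_cong[OF D(2)])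
        (use False sep in \<open>force simp: vec_eq_iff tagged_def\<close>)
  qed
qed simp

text \<open>On one row Alice's label and the tag are constant, so the state is a product and only
  Bob's factor depends on \<open>\<phi>\<close>.\<close>

lemma locc_dist_row:
  assumes S: "finite S"
    and orth: "pairwise (\<lambda>\<phi> \<phi>'. cinner_on ({i} \<times> J) \<phi> \<phi>' = 0) S"
  shows "locc_dist S (tagged g ({i} \<times> J))"
proof -
  define u where "u \<phi> = (\<chi> q. if fst q = g i \<and> snd q \<in> J then \<phi> $ (i, snd q) else 0)"
    for \<phi> :: "complex ^ ('a \<times> 'b)"
  have "cinner (u \<phi>) (u \<phi>') = 0" if "\<phi> \<in> S" "\<phi>' \<in> S" "\<phi> \<noteq> \<phi>'" for \<phi> \<phi>'
  proof -
    have "cinner (u \<phi>) (u \<phi>') = (\<Sum>q\<in>{g i} \<times> J. cnj (\<phi> $ (i, snd q)) * \<phi>' $ (i, snd q))"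
      unfolding cinner_def by (rule sum.mono_neutral_cong_right) (auto simp: u_def)
    also have "\<dots> = cinner_on ({i} \<times> J) \<phi> \<phi>'"
      by (simp add: cinner_on_def sum.cartesian_product')
    finally show ?thesis using orth that by (simp add: pairwise_def)
  qed
  then have "locc_dist S (\<lambda>\<phi>. ket (0, i) \<otimes> u \<phi>)"
    by (intro locc_dist_orthogonal_Bob S)
  then show ?thesis
    by (rule locc_dist_cong) (auto simp: vec_eq_iff tagged_def u_def tensor_vec_def ket_def axis_def)
qed

text \<open>Bob erases his tag by measuring it in a basis unbiased to the standard one; the phases
  this causes on Alice's side do not affect orthogonality.\<close>

lemma locc_dist_column:
  fixes g :: "'c::finite \<Rightarrow> 'r::{finite,zero}" and H :: "((complex, 'r) vec, 'r) vec"
    and S :: "(complex ^ ('c \<times> 'd::finite)) set"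
  assumes S: "finite S"
    and H: "dagger H ** H = mat 1" "\<And>x k. cnj (H $ x $ k) * H $ x $ k = c"
    and orth: "pairwise (\<lambda>\<phi> \<phi>'. cinner_on (I \<times> {j}) \<phi> \<phi>' = 0) S"
  shows "locc_dist S (tagged g (I \<times> {j}))"
proof -
  \<comment> \<open>Outcome \<open>x\<close> contracts the tag with row \<open>x\<close> of
    \<open>H\<close>, resets the tag to \<open>0\<close> and keeps Bob's own label.\<close>
  define N :: "'r \<Rightarrow> complex ^ ('r \<times> 'd) ^ ('r \<times> 'd)" where
    "N x = (\<chi> p q. if fst p = 0 \<and> snd p = snd q then H $ x $ fst q else 0)" for x
  have N: "(\<Sum>x\<in>UNIV. dagger (N x) ** N x) = mat 1"
  proof -
    have "(\<Sum>x\<in>UNIV. dagger (N x) ** N x) $ (l, j) $ (l', j') = mat 1 $ (l, j) $ (l', j')" for l j l' j'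
    proof -
      have "(\<Sum>k\<in>UNIV. cnj (N x $ k $ (l, j)) * N x $ k $ (l', j')) =
        (\<Sum>k\<in>{(0::'r, j)}. if j = j' then cnj (H $ x $ l) * H $ x $ l' else 0)" for x
        by (rule sum.mono_neutral_cong_right) (auto simp: N_def)
      then have "(\<Sum>x\<in>UNIV. dagger (N x) ** N x) $ (l, j) $ (l', j') =
        (if j = j' then (dagger H ** H) $ l $ l' else 0)"
        by (simp add: dagger_mult_nth)
      then show ?thesis unfolding H by (simp add: mat_def)
    qed
    then show ?thesis by (simp add: vec_eq_iff)
  qed
  show ?thesis
  proof (rule locc_dist_Bob[OF _ N], goal_cases)
    case (2 x)
    define u :: "_ \<Rightarrow> complex ^ ('r \<times> 'c)" where "u \<phi> = (\<chi> q. if fst q = 0 \<and> snd q \<in> I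
        then H $ x $ g (snd q) * \<phi> $ (snd q, j) else 0)"
      for \<phi> :: "complex ^ ('c \<times> 'd)"
    have phase: "cnj (H $ x $ k * a) * (H $ x $ k * b) = c * (cnj a * b)" for k a b
      by (simp add: H(2)[of x k, symmetric] mult_ac)
    have "cinner (u \<phi>) (u \<phi>') = 0" if "\<phi> \<in> S" "\<phi>' \<in> S" "\<phi> \<noteq> \<phi>'" for \<phi> \<phi>'
    proof -
      have "cinner (u \<phi>) (u \<phi>') = (\<Sum>q\<in>{0::'r} \<times> I. c * (cnj (\<phi> $ (snd q, j)) * \<phi>' $ (snd q, j)))"
        unfolding cinner_def
        by (rule sum.mono_neutral_cong_right) (auto simp: u_def phase simp del: complex_cnj_mult)
      also have "\<dots> = c * cinner_on (I \<times> {j}) \<phi> \<phi>'"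
        by (simp add: cinner_on_def sum.cartesian_product' sum_distrib_left)
      finally show ?thesis using orth that by (simp add: pairwise_def)
    qed
    then have "locc_dist S (\<lambda>\<phi>. u \<phi> \<otimes> ket (0, j))"
      by (intro locc_dist_orthogonal_Alice S)
    moreover have "(mat 1 \<otimes>\<^sub>m N x) *v tagged g (I \<times> {j}) \<phi> = u \<phi> \<otimes> ket (0, j)" for \<phi>
    proof -
      have "(\<Sum>b\<in>UNIV. N x $ (l, j') $ b * tagged g (I \<times> {j}) \<phi> $ ((k, i), b)) =
        (\<Sum>b\<in>{(g i, j)}. if l = 0 \<and> j' = j \<and> k = 0 \<and> i \<in> I then H $ x $ g i * \<phi> $ (i, j) else 0)"
        for l j' k i
        by (rule sum.mono_neutral_cong_right) (auto simp: N_def tagged_def split: if_splits)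
      then show ?thesis
        by (auto simp: Bob_apply vec_eq_iff u_def tensor_vec_def ket_def axis_def)
    qed
    ultimately show ?case by simp
  qed simp
qed


section \<open>The two Bell pairs and the tiles\<close>

text \<open>After regrouping, both registers are indexed by the group Z_2 x Z_2, as the tagging step
  requires.\<close>

lemma bell_bell_nth: "(bell \<otimes>\<^sub>b bell) $ (k, l) = (if k = l then 1 else 0)"
proof -
  have "bell $ (a, b) = (if a = b then 1 else 0)" for a b
    using exhaust_2[of a] exhaust_2[of b]
    by (auto simp: bell_def tensor_vec_def ket_def axis_def)
  then show ?thesis
    by (cases k; cases l) (simp add: tensor_bipartite_def)
qed

text \<open>The tensor square of the Hadamard matrix: unitary, with all entries of modulus
  1/2.\<close>

definition hadamard4 :: "complex ^ (2 \<times> 2) ^ (2 \<times> 2)" where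
  "hadamard4 = (\<chi> p q. (if fst p = 1 \<and> fst q = 1 then - 1 else 1) *
     (if snd p = 1 \<and> snd q = 1 then - 1 else 1) / 2)"

lemma hadamard4_unitary: "dagger hadamard4 ** hadamard4 = mat 1"
  by (simp add: vec_eq_iff dagger_mult_nth hadamard4_def mat_def forall_2 sum_2
      sum.cartesian_product' UNIV_Times_UNIV[symmetric] del: UNIV_Times_UNIV)

lemma hadamard4_unbiased: "cnj (hadamard4 $ x $ k) * hadamard4 $ x $ k = 1 / 4"
  by (simp add: hadamard4_def)

lemma cinner_on_linear:
  "cinner_on R (u + v) w = cinner_on R u w + cinner_on R v w"
  "cinner_on R (u - v) w = cinner_on R u w - cinner_on R v w"
  "cinner_on R w (u + v) = cinner_on R w u + cinner_on R w v"
  "cinner_on R w (u - v) = cinner_on R w u - cinner_on R w v"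
  by (simp_all add: cinner_on_def algebra_simps sum.distrib sum_subtractf)

lemma cinner_on_ket: "cinner_on R (ket i) (ket j) = (if i = j \<and> i \<in> R then 1 else 0)"
  by (simp add: cinner_on_def ket_def axis_def if_distrib[of cnj] if_distrib[of "\<lambda>x. x * _"]
      cong: if_cong)

lemma cinner_on_tensor_vec:
  "cinner_on (I \<times> J) (u \<otimes> v) (u' \<otimes> v') = cinner_on I u u' * cinner_on J v v'"
  by (simp add: cinner_on_def tensor_vec_def sum_product sum.cartesian_product' mult_ac)

text \<open>By conjugate symmetry one order of each pair suffices, which reduces orthogonality on a
  tile to a computation along the list.\<close>

lemma pairwise_cinner_on:
  assumes "sorted_wrt (\<lambda>\<phi> \<psi>. cinner_on R \<phi> \<psi> = 0) xs"
  shows "pairwise (\<lambda>\<phi> \<psi>. cinner_on R \<phi> \<psi> = 0) (set xs)"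
proof -
  have "cnj (cinner_on R \<phi> \<psi>) = cinner_on R \<psi> \<phi>" for \<phi> \<psi>
    by (simp add: cinner_on_def mult.commute)
  then have "cinner_on R \<psi> \<phi> = 0" if "cinner_on R \<phi> \<psi> = 0" for \<phi> \<psi>
    using that by (metis complex_cnj_zero)
  with assms show ?thesis
    by (induction xs) (auto simp: pairwise_insert)
qed

text \<open>Four tags serve five labels. Rows \<open>2\<close> and \<open>3\<close> lie in the same
  tile in columns \<open>0\<close>, \<open>1\<close> and \<open>4\<close>, so merging them only
  confuses \<open>{3} \<times> {2,3}\<close> with its neighbours \<open>{1,2} \<times> {3}\<close>
  and \<open>{2} \<times> {2}\<close>.\<close>

definition tag :: "5 \<Rightarrow> 2 \<times> 2" where
  "tag i = (if i = 0 then (0, 0) else if i = 1 then (0, 1) else if i = 4 then (1, 1) else (1, 0))"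

lemma UNIV_5: "(UNIV :: 5 set) = {0, 1, 2, 3, 4}"
  by (rule sym, rule card_subset_eq) auto

theorem theorem2:
  "distinguishable_with (bell \<otimes>\<^sub>b bell) (set states_list)"
proof (rule distinguishable_withI, rule locc_dist_tag[where g = tag])
  note row = locc_dist_row[OF finite_set pairwise_cinner_on]
  note column = locc_dist_column[OF finite_set hadamard4_unitary hadamard4_unbiased
      pairwise_cinner_on]
  note bob = locc_dist_split_Bob[where g = tag]
  note orth = states_list_def cinner_on_tensor_vec cinner_on_linear cinner_on_ket
  let ?D = "\<lambda>R. locc_dist (set states_list) (tagged tag R)"
  \<comment> \<open>Keeping the tile in product form lets the restricted inner products factor.
    States of other tiles restrict to zero, and the signs of this tile's states sum to zero against
    the uniform restriction of F.\<close>
  have 1: "?D ({0} \<times> {0,1,2,3})" by (rule row) (simp add: orth del: insert_Times_insert)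
  have 2: "?D ({0,1,2,3} \<times> {4})" by (rule column) (simp add: orth del: insert_Times_insert)
  have 3: "?D ({4} \<times> {1,2,3,4})" by (rule row) (simp add: orth del: insert_Times_insert)
  have 4: "?D ({1,2,3,4} \<times> {0})" by (rule column) (simp add: orth del: insert_Times_insert)
  have 5: "?D ({1} \<times> {1,2})" by (rule row) (simp add: orth del: insert_Times_insert)
  have 6: "?D ({2,3} \<times> {1})" by (rule column) (simp add: orth del: insert_Times_insert)
  have 7: "?D ({3} \<times> {2,3})" by (rule row) (simp add: orth del: insert_Times_insert)
  have 8: "?D ({1,2} \<times> {3})" by (rule column) (simp add: orth del: insert_Times_insert)
  \<comment> \<open>Only F is nonzero on the centre.\<close>
  have 9: "?D ({2} \<times> {2})" by (rule row) (simp add: orth del: insert_Times_insert)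
  \<comment> \<open>The regions are assembled in reverse order of the protocol: each later union
    adds a tile that is split off earlier.\<close>
  have "?D ({1,2} \<times> {3} \<union> {2} \<times> {2})"
    by (rule bob[OF 8 9]) auto
  \<comment> \<open>This split is Alice's, since in column \<open>3\<close> the rows
    \<open>2\<close> and \<open>3\<close> carry the same tag.\<close>
  then have "?D ({3} \<times> {2,3} \<union> ({1,2} \<times> {3} \<union> {2} \<times> {2}))"
    by (rule locc_dist_split_Alice[OF 7]) auto
  then have "?D ({2,3} \<times> {1} \<union> ({3} \<times> {2,3} \<union> ({1,2} \<times> {3} \<union> {2} \<times> {2})))"
    by (rule bob[OF 6]) (auto simp: tag_def)
  \<comment> \<open>The tag of row \<open>1\<close> separates this tile from rows \<open>2\<close>
    and \<open>3\<close> in columns \<open>1\<close> and \<open>2\<close>.\<close>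
  then have "?D ({1} \<times> {1,2} \<union> ({2,3} \<times> {1} \<union> ({3} \<times> {2,3} \<union> ({1,2} \<times> {3} \<union> {2} \<times> {2}))))"
    by (rule bob[OF 5]) (auto simp: tag_def)
  then have "?D ({1,2,3,4} \<times> {0} \<union> ({1} \<times> {1,2} \<union> ({2,3} \<times> {1} \<union>
      ({3} \<times> {2,3} \<union> ({1,2} \<times> {3} \<union> {2} \<times> {2})))))"
    by (rule bob[OF 4]) (auto simp: tag_def)
  then have "?D ({4} \<times> {1,2,3,4} \<union> ({1,2,3,4} \<times> {0} \<union> ({1} \<times> {1,2} \<union> ({2,3} \<times> {1} \<union>
      ({3} \<times> {2,3} \<union> ({1,2} \<times> {3} \<union> {2} \<times> {2}))))))"
    by (rule bob[OF 3]) (auto simp: tag_def)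
  then have "?D ({0,1,2,3} \<times> {4} \<union> ({4} \<times> {1,2,3,4} \<union> ({1,2,3,4} \<times> {0} \<union> ({1} \<times> {1,2} \<union>
      ({2,3} \<times> {1} \<union> ({3} \<times> {2,3} \<union> ({1,2} \<times> {3} \<union> {2} \<times> {2})))))))"
    by (rule bob[OF 2]) (auto simp: tag_def)
  then have "?D ({0} \<times> {0,1,2,3} \<union> ({0,1,2,3} \<times> {4} \<union> ({4} \<times> {1,2,3,4} \<union> ({1,2,3,4} \<times> {0} \<union>
      ({1} \<times> {1,2} \<union> ({2,3} \<times> {1} \<union> ({3} \<times> {2,3} \<union> ({1,2} \<times> {3} \<union> {2} \<times> {2}))))))))"
    by (rule bob[OF 1]) (auto simp: tag_def)
  \<comment> \<open>Four outer tiles of 4 cells, four inner ones of 2 and the centre fill all 25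
    cells.\<close>
  also have "({0} \<times> {0,1,2,3} \<union> ({0,1,2,3} \<times> {4} \<union> ({4} \<times> {1,2,3,4} \<union> ({1,2,3,4} \<times> {0} \<union>
      ({1} \<times> {1,2} \<union> ({2,3} \<times> {1} \<union> ({3} \<times> {2,3} \<union> ({1,2} \<times> {3} \<union> {2} \<times> {2})))))))) =
      (UNIV :: (5 \<times> 5) set)"
    unfolding UNIV_Times_UNIV[symmetric] UNIV_5 by auto
  finally show "?D UNIV" .
qed (rule bell_bell_nth)

end
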